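(* Let $R$ be a VNL ring. Then for every idempotent $e$ of $R$, either $eRe$ or $(1-e)R(1-e)$ is a regular ring.
   Context: Rings are associative with identity. An element $a$ of a ring $R$ is (von Neumann) regular if $a=aba$ for some $b\in R$; a ring is regular if all its elements are regular (the zero ring is regular). A ring $R$ is VNL if for each $a\in R$, either $a$ or $1-a$ is regular in $R$. For an idempotent $e$, $eRe$ is the corner ring with identity $e$. *)

theory Defs
  imports "HOL-Algebra.Ring"
begin

definition vn_regular :: "('a, 'm) ring_scheme \<Rightarrow> 'a \<Rightarrow> bool" where
  "vn_regular R a \<longleftrightarrow>
     a \<in> carrier R \<and> (\<exists>b \<in> carrier R. a = a \<otimes>\<^bsub>R\<^esub> b \<otimes>\<^bsub>R\<^esub> a)"

text \<open>The locale of rings does not require that zero and one differ, so the zero ring is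
  included throughout.\<close>

definition regular_ring :: "('a, 'm) ring_scheme \<Rightarrow> bool" where
  "regular_ring R \<longleftrightarrow> ring R \<and> (\<forall>a \<in> carrier R. vn_regular R a)"

definition VNL_ring :: "('a, 'm) ring_scheme \<Rightarrow> bool" where
  "VNL_ring R \<longleftrightarrow>
     ring R \<and> (\<forall>a \<in> carrier R. vn_regular R a \<or> vn_regular R (\<one>\<^bsub>R\<^esub> \<ominus>\<^bsub>R\<^esub> a))"

definition idempotent_elem :: "('a, 'm) ring_scheme \<Rightarrow> 'a \<Rightarrow> bool" where
  "idempotent_elem R e \<longleftrightarrow> e \<in> carrier R \<and> e \<otimes>\<^bsub>R\<^esub> e = e"

text \<open>The corner \<open>eRe\<close>: addition, multiplication and zero are those of \<open>R\<close>, the identity is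
  \<open>e\<close>. It is meant to be used with an idempotent \<open>e\<close> only.\<close>

definition corner_ring :: "('a, 'm) ring_scheme \<Rightarrow> 'a \<Rightarrow> ('a, 'm) ring_scheme" where
  "corner_ring R e =
     R\<lparr>carrier := {e \<otimes>\<^bsub>R\<^esub> x \<otimes>\<^bsub>R\<^esub> e | x. x \<in> carrier R}, one := e\<rparr>"

lemma (in ring) idempotent_elem_compl:
  assumes "idempotent_elem R e"
  shows "idempotent_elem R (\<one> \<ominus> e)"
proof -
  have e: "e \<in> carrier R" "e \<otimes> e = e" using assms by (auto simp: idempotent_elem_def)
  have "(\<one> \<ominus> e) \<otimes> (\<one> \<ominus> e) = \<one> \<ominus> e"
    using e by (simp add: a_minus_def l_distr r_distr l_minus r_minus r_neg)
  then show ?thesis using e by (simp add: idempotent_elem_def)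
qed

lemma (in ring) corner_ring_is_ring:
  assumes "idempotent_elem R e"
  shows "ring (corner_ring R e)"
proof -
  have e: "e \<in> carrier R" "e \<otimes> e = e" using assms by (auto simp: idempotent_elem_def)
  have ee: "e \<otimes> (e \<otimes> x) = e \<otimes> x" if "x \<in> carrier R" for x
    using e that by (metis m_assoc)
  have iff: "{e \<otimes> x \<otimes> e | x. x \<in> carrier R} = {x \<in> carrier R. e \<otimes> x = x \<and> x \<otimes> e = x}" 
    (is "?A = ?B")
  proof
    show "?A \<subseteq> ?B" using e ee by (auto simp: m_assoc)
    show "?B \<subseteq> ?A"
    proof
      fix x assume "x \<in> ?B"
      then have "x = e \<otimes> x \<otimes> e" "x \<in> carrier R" by auto
      then show "x \<in> ?A" by blast
    qed
  qed
  show ?thesis unfolding corner_ring_def iff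
  proof (rule ringI)
    show "abelian_group (R\<lparr>carrier := {x \<in> carrier R. e \<otimes> x = x \<and> x \<otimes> e = x}, one := e\<rparr>)"
    proof (rule abelian_groupI, goal_cases)
      case (6 x) then show ?case
        using e by (intro bexI[of _ "\<ominus> x"]) (auto simp: l_neg l_minus r_minus)
    qed (use e in \<open>auto simp: r_distr l_distr a_ac\<close>)
    show "monoid (R\<lparr>carrier := {x \<in> carrier R. e \<otimes> x = x \<and> x \<otimes> e = x}, one := e\<rparr>)"
    proof (rule monoidI, goal_cases)
      case (1 x y) then show ?case
        using e by (auto simp: m_assoc) (metis m_assoc)
    qed (use e in \<open>auto simp: m_assoc\<close>)
  qed (auto simp: l_distr r_distr)
qed

end

theory Submission
  imports Defs
begin

text \<open>If \<open>a \<in> eRe\<close> and \<open>b \<in> (1-e)R(1-e)\<close> were both non-regular in their corners, apply the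
  VNL condition to \<open>x = a + (1-e) - b\<close>: here \<open>ex = a = xe\<close>, whereas
  \<open>(1-e)(1-x) = b = (1-x)(1-e)\<close>, and regularity of an element passes to such a diagonal
  block.\<close>

lemma corner_ring_carrierE:
  assumes "ring R" and "idempotent_elem R e" and "a \<in> carrier (corner_ring R e)"
  shows "a \<in> carrier R" and "e \<otimes>\<^bsub>R\<^esub> a = a" and "a \<otimes>\<^bsub>R\<^esub> e = a"
proof -
  interpret ring R by fact
  have e: "e \<in> carrier R" "e \<otimes>\<^bsub>R\<^esub> e = e" using assms(2) by (auto simp: idempotent_elem_def)
  obtain x where x: "x \<in> carrier R" "a = e \<otimes>\<^bsub>R\<^esub> x \<otimes>\<^bsub>R\<^esub> e"
    using assms(3) by (auto simp: corner_ring_def)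
  show "a \<in> carrier R" using e x by simp
  show "e \<otimes>\<^bsub>R\<^esub> a = a" using e x by (metis m_assoc m_closed)
  show "a \<otimes>\<^bsub>R\<^esub> e = a" using e x by (metis m_assoc m_closed)
qed

text \<open>Multiplying \<open>x = x y x\<close> by \<open>e\<close> on both sides turns the outer
  factors into \<open>e x = a\<close> and \<open>x e = a\<close>, so \<open>a = a y a\<close>. Since
  \<open>a = a e = e a\<close>, the inner inverse \<open>y\<close> can be replaced by
  \<open>e y e\<close>, which lies in the corner.\<close>

lemma (in ring) vn_regular_corner_block:
  assumes "idempotent_elem R e" and "vn_regular R x"
    and "e \<otimes> x = a" and "x \<otimes> e = a"
  shows "vn_regular (corner_ring R e) a"
proof -
  have e: "e \<in> carrier R" "e \<otimes> e = e" using assms(1) by (auto simp: idempotent_elem_def)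
  obtain y where y: "y \<in> carrier R" "x = x \<otimes> y \<otimes> x" and x: "x \<in> carrier R"
    using assms(2) by (auto simp: vn_regular_def)
  have a: "a \<in> carrier R" using assms(3) e x by auto
  have ea: "e \<otimes> a = a" and ae: "a \<otimes> e = a"
    using assms(3,4) e x by (metis m_assoc)+
  have exe: "a = e \<otimes> x \<otimes> e" using assms(3) ae by simp
  also have "\<dots> = e \<otimes> (x \<otimes> y \<otimes> x) \<otimes> e" using y by simp
  also have "\<dots> = (e \<otimes> x) \<otimes> y \<otimes> (x \<otimes> e)" using e x y(1) by (simp add: m_assoc)
  also have "\<dots> = (a \<otimes> e) \<otimes> y \<otimes> (e \<otimes> a)" using assms(3,4) ea ae by simp
  also have "\<dots> = a \<otimes> (e \<otimes> y \<otimes> e) \<otimes> a" using e a y(1) by (simp add: m_assoc)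
  finally have "a = a \<otimes> (e \<otimes> y \<otimes> e) \<otimes> a" .
  then show ?thesis
    \<comment> \<open>\<open>exe\<close> exhibits \<open>a\<close> itself as an element of the
      corner, which \<open>vn_regular\<close> also demands.\<close>
    using exe x y(1) by (auto simp: vn_regular_def corner_ring_def)
qed

theorem lemma2p4:
  fixes R :: "('a, 'm) ring_scheme" (structure)
  assumes "VNL_ring R"
  shows "\<forall>e. idempotent_elem R e \<longrightarrow>
           regular_ring (corner_ring R e) \<or> regular_ring (corner_ring R (\<one> \<ominus> e))"
proof (intro allI impI, rule ccontr)
  fix e assume idem: "idempotent_elem R e"
    and no: "\<not> (regular_ring (corner_ring R e) \<or> regular_ring (corner_ring R (\<one> \<ominus> e)))"
  interpret ring R using assms by (simp add: VNL_ring_def)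
  define f where "f = \<one> \<ominus> e"
  have idem': "idempotent_elem R f" unfolding f_def by (rule idempotent_elem_compl[OF idem])
  have e: "e \<in> carrier R" "e \<otimes> e = e" and f: "f \<in> carrier R" "f \<otimes> f = f"
    using idem idem' by (auto simp: idempotent_elem_def)
  have ef: "e \<otimes> f = \<zero>" and fe: "f \<otimes> e = \<zero>"
    using e by (simp_all add: f_def a_minus_def l_distr r_distr l_minus r_minus r_neg)
  \<comment> \<open>\<open>regular_ring\<close> asks for a ring as well; the corner is one, so its
    failure must come from a non-regular element.\<close>
  obtain a where a: "a \<in> carrier (corner_ring R e)" "\<not> vn_regular (corner_ring R e) a"
    using no corner_ring_is_ring[OF idem] by (auto simp: regular_ring_def)
  obtain b where b: "b \<in> carrier (corner_ring R f)" "\<not> vn_regular (corner_ring R f) b"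
    using no corner_ring_is_ring[OF idem'] by (auto simp: regular_ring_def f_def)
  note a' = corner_ring_carrierE[OF ring_axioms idem a(1)]
  note b' = corner_ring_carrierE[OF ring_axioms idem' b(1)]
  \<comment> \<open>Absorbing \<open>f\<close> into \<open>b\<close>, and \<open>e\<close> into
    \<open>a\<close> below, reduces every cross product to \<open>e f = 0\<close> or
    \<open>f e = 0\<close>.\<close>
  have eb: "e \<otimes> b = \<zero>" and be: "b \<otimes> e = \<zero>"
    using b' e f ef fe by (metis m_assoc l_null r_null)+
  have fa: "f \<otimes> a = \<zero>" and af: "a \<otimes> f = \<zero>"
    using a' e f ef fe by (metis m_assoc l_null r_null)+
  define x where "x = a \<oplus> (f \<ominus> b)"
  have x: "x \<in> carrier R" using a' b' f by (simp add: x_def)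
  have "e \<otimes> x = a" "x \<otimes> e = a"
    using a' b' e f ef fe eb be
    by (simp_all add: x_def a_minus_def l_distr r_distr l_minus r_minus)
  then have "\<not> vn_regular R x" using vn_regular_corner_block[OF idem] a(2) by blast
  \<comment> \<open>The \<open>f\<close>-block of \<open>x\<close> is \<open>f - b\<close>, and
    \<open>f\<close> is the identity of that corner, so the \<open>f\<close>-block of
    \<open>1 - x\<close> is \<open>f - (f - b) = b\<close>; the summand \<open>a\<close> is killed
    by \<open>f\<close> on either side.\<close>
  moreover have "f \<otimes> (\<one> \<ominus> x) = b" "(\<one> \<ominus> x) \<otimes> f = b"
    using a' b' f fa af
    by (simp_all add: x_def a_minus_def l_distr r_distr l_minus r_minus minus_add r_neg r_neg1 r_neg2)
  then have "\<not> vn_regular R (\<one> \<ominus> x)" using vn_regular_corner_block[OF idem'] b(2) by blast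
  ultimately show False using assms x by (auto simp: VNL_ring_def)
qed

end
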